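(* Let $A=T[0,a_1,\dots,a_{n-1}]$ be a symmetric Boolean Toeplitz matrix of order $n$ with $S_A\neq\emptyset$ and $2\min S_A\le n$. Let $d=\mathrm{DA}(n,S_A)$, and let $q$ and $r$ be integers satisfying $n=qd+r$ and $0\le r<d$. Then $$G(A)/\mathbb{Z}_d\cong G(B)/\mathbb{Z}_d,$$ where $B=T[0,b_1,\dots,b_{d+r-1}]$ with $$b_i=\begin{cases}0&\text{if } i\le r;\\ a_{(q-1)d+i}&\text{if } r<i<d+r \text{ and } i\neq d;\\ 1&\text{if } i=d.\end{cases}$$ Further, $G(A)$ and $G(B)$ have the same number of connected components.
   Context: For $a_0,\dots,a_{n-1}$, $T[a_0,a_1,\dots,a_{n-1}]$ denotes the symmetric Toeplitz matrix of order $n$ whose $(i,j)$ entry is $a_{|i-j|}$, $i,j\in[n]=\{1,\dots,n\}$. Boolean means all entries are in $\{0,1\}$. For such a matrix $A$ of order $n$, $S_A=\{i\in\{0,\dots,n-1\}: a_i\neq0\}$, and $G(A)$ is the graph with vertex set $[n]$ in which $i$ and $j$ are adjacent if and only if $|i-j|\in S_A$. (In the definition of $B$, $b_i$ is needed only for $1\le i\le d+r-1$; so when $r=0$ the case $i=d$ does not occur. $B$ has order $d+r$.) Definition of $\mathrm{DA}(n,S)$: let $n$ be a positive integer and $S$ a nonempty subset of $[n-1]$ with $2\min S\le n$. Set $S_1=S\setminus\{\min S\}$ and $d_1=\min S$. For $i=1,2,\dots$: as long as $S_i\neq\emptyset$ and $\min S_i\le n-d_i$, set $S_{i+1}=S_i\setminus\{\min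 S_i\}$ and $d_{i+1}=\gcd(d_i,\min S_i)$, and continue with $i+1$. At the first $i$ for which $S_i=\emptyset$ or $\min S_i>n-d_i$, stop and output $\mathrm{DA}(n,S)=d_i$. Contraction: for a graph $G$ with vertex set $[n]$ and a positive integer $d$, $G/\mathbb{Z}_d$ is the simple (loopless) graph with vertex set $\{[1]_d,[2]_d,\dots,[d]_d\}$, where $[i]_d=\{v\in[n]: v\equiv i\pmod d\}$, and distinct vertices $[i]_d$ and $[j]_d$ are adjacent if and only if $xy$ is an edge of $G$ for some $x\in[i]_d$ and $y\in[j]_d$. *)

theory Defs
  imports
    "Jordan_Normal_Form.Matrix"
    "Graph_Theory.Graph_Theory"
    "HOL-Number_Theory.Cong"
begin

text \<open>
  Matrices of type \<^typ>\<open>'a mat\<close> are indexed from \<open>0\<close>; since only differences of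
  indices occur in a Toeplitz matrix, this agrees with indexing by \<open>{1..n}\<close>.
  Only the values \<open>a 0, \<dots>, a (n - 1)\<close> are used.
\<close>

definition toeplitz :: "nat \<Rightarrow> (nat \<Rightarrow> 'a) \<Rightarrow> 'a mat" where
  "toeplitz n a = mat n n (\<lambda>(i, j). a (nat \<bar>int i - int j\<bar>))"

definition boolean_mat :: "'a::zero_neq_one mat \<Rightarrow> bool" where
  "boolean_mat A \<longleftrightarrow> elements_mat A \<subseteq> {0, 1}"

text \<open>The entry of \<^term>\<open>toeplitz n a\<close> at position \<open>(0, i)\<close> is \<^term>\<open>a i\<close>.\<close>

definition toeplitz_support :: "'a::zero mat \<Rightarrow> nat set" where
  "toeplitz_support A = {i. i < dim_col A \<and> A $$ (0, i) \<noteq> 0}"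

text \<open>
  Undirected graphs are represented as symmetric digraphs, an edge \<open>xy\<close> being the two arcs
  \<open>(x, y)\<close> and \<open>(y, x)\<close>.
\<close>

definition toeplitz_graph :: "'a::zero mat \<Rightarrow> nat pair_pre_digraph" where
  "toeplitz_graph A =
     \<lparr> pverts = {1..dim_row A},
       parcs = {(i, j). i \<in> {1..dim_row A} \<and> j \<in> {1..dim_row A} \<and>
                        nat \<bar>int i - int j\<bar> \<in> toeplitz_support A} \<rparr>"

text \<open>
  \<open>DA_loop n d S\<close> runs the algorithm from a state \<open>d\<^sub>i = d\<close>, \<open>S\<^sub>i = S\<close>. The finiteness guard is
  only there for termination: the algorithm is run on subsets of \<open>{1..n - 1}\<close>. There
  \<open>d\<^sub>i \<le> min S \<le> n\<close>, so the subtraction \<open>n - d\<close> is not truncated.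
\<close>

function DA_loop :: "nat \<Rightarrow> nat \<Rightarrow> nat set \<Rightarrow> nat" where
  "DA_loop n d S =
     (if finite S \<and> S \<noteq> {} \<and> Min S \<le> n - d
      then DA_loop n (gcd d (Min S)) (S - {Min S})
      else d)"
  by pat_completeness auto
termination
  by (relation "measure (\<lambda>(n, d, S). card S)") (auto intro!: diff_less simp: card_gt_0_iff)

declare DA_loop.simps [simp del]

definition DA :: "nat \<Rightarrow> nat set \<Rightarrow> nat" where
  "DA n S = DA_loop n (Min S) (S - {Min S})"

definition residue_class :: "nat pair_pre_digraph \<Rightarrow> nat \<Rightarrow> nat \<Rightarrow> nat set" where
  "residue_class G d i = {v \<in> pverts G. [v = i] (mod d)}"

definition contraction :: "nat pair_pre_digraph \<Rightarrow> nat \<Rightarrow> nat set pair_pre_digraph" where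
  "contraction G d =
     \<lparr> pverts = residue_class G d ` {1..d},
       parcs = {(X, Y). X \<in> residue_class G d ` {1..d} \<and> Y \<in> residue_class G d ` {1..d} \<and>
                        X \<noteq> Y \<and> (\<exists>x\<in>X. \<exists>y\<in>Y. (x, y) \<in> parcs G)} \<rparr>"

text \<open>
  Components are the maximal connected subgraphs. \<open>Digraph_Component.connected\<close> is
  connectedness of the underlying undirected graph.
\<close>

definition connected_components :: "('a, 'b) pre_digraph \<Rightarrow> ('a, 'b) pre_digraph set" where
  "connected_components G = {H. pre_digraph.max_subgraph G Digraph_Component.connected H}"

end

theory Submission
  imports Defs
begin

text \<open>
  Both claims follow from two facts about the residue classes modulo \<open>d\<close>.

  First, \<open>G(A)\<close> and \<open>G(B)\<close> join the same pairs of distinct residues. The algorithm only stops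
  when every element of \<open>S\<^sub>A\<close> has been absorbed into the gcd, hence is a multiple of \<open>d\<close>, or exceeds
  \<open>n - d\<close> (\<open>DA_loop_dvd_or_large\<close>). Multiples of \<open>d\<close> only give edges inside a residue class. An
  element \<open>s > n - d\<close> that is not a multiple of \<open>d\<close> can be written \<open>s = (q - 1) d + i\<close> with
  \<open>r < i\<close> and \<open>i \<noteq> d\<close>, and an edge of length \<open>s\<close>
  starts at some \<open>x \<le> n - s = d + r - i\<close>; so \<open>{x, x + i}\<close> fits into \<open>{1..d + r}\<close>, joins the same
  residues, and is an edge of \<open>G(B)\<close> by the choice of \<open>b\<^sub>i\<close>. The passage can be reversed. This is
  the isomorphism of contractions (\<open>contraction_iso\<close>).

  Second, in both graphs the vertices of one residue class lie in one component. For \<open>G(B)\<close> this is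
  what the entry \<open>b\<^sub>d = 1\<close> achieves (if \<open>r = 0\<close>, each class is a single vertex). For \<open>G(A)\<close> it is an invariant of the algorithm
  (\<open>residue_connected_DA_loop\<close>): if the classes modulo \<open>d\<^sub>i\<close> are connected and \<open>s \<le> n - d\<^sub>i\<close>, then
  every class modulo \<open>d\<^sub>i\<close> has a representative \<open>z \<le> d\<^sub>i\<close>, from which the edge to \<open>z + s \<le> n\<close> exists.
  So one can move by \<open>s\<close> from every class, and these moves join all classes modulo \<open>d\<^sub>i\<close> that
  agree modulo \<open>gcd d\<^sub>i s\<close>.

  A graph with connected residue classes has as many components as its contraction, so equal adjacency
  of residues gives equal numbers of components (\<open>card_connected_components_eq\<close>).
\<close>

section \<open>Components of symmetric graphs\<close>

lemma (in wf_digraph) strongly_connected_imp_connected: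
  assumes "strongly_connected G" shows "Digraph_Component.connected G"
  using assms by (intro connectedI) (auto simp: strongly_connected_def intro: reachable_mk_symmetricI)

text \<open>
  A maximal connected subgraph is induced, as adding arcs keeps a subgraph connected. An induced
  subgraph of a symmetric digraph is symmetric, and for symmetric digraphs connectedness and strong
  connectedness agree. This gives access to the theory of strongly connected components.
\<close>
lemma (in sym_digraph) connected_components_eq_sccs: "connected_components G = sccs"
proof -
  have mono: "arc_mono Digraph_Component.connected"
    unfolding arc_mono_def
    by (metis subgraph_def spanning_def wf_digraph.connected_spanning_imp_connected)
  have strong: "strongly_connected H"
    if "induced_subgraph H G" "Digraph_Component.connected H" for H :: "('a, 'b) pre_digraph"
    using that sym_arcs
    by (meson induced_graph_imp_symmetric wf_digraph.symmetric_connected_imp_strongly_connected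
        wf_digraphI_induced)
  have weak: "Digraph_Component.connected H"
    if "strongly_connected H" "subgraph H G" for H :: "('a, 'b) pre_digraph"
    using that by (meson wf_digraph.strongly_connected_imp_connected subgraph_def)
  have "max_subgraph Digraph_Component.connected H \<longleftrightarrow> max_subgraph strongly_connected H"
    (is "?C \<longleftrightarrow> ?S") for H
  proof
    assume ?C
    then have "strongly_connected H"
      using induced_subgraphI_arc_mono[OF _ mono] strong max_subgraph_prop by blast
    with \<open>?C\<close> weak show ?S
      unfolding max_subgraph_def by blast
  next
    assume S: ?S
    show ?C
    proof (rule max_subgraphI)
      show "Digraph_Component.connected H" "subgraph H G"
        using S weak unfolding max_subgraph_def by auto
    next
      fix K assume K: "H \<noteq> K" "subgraph H K" "subgraph K G"
      show "\<not> Digraph_Component.connected K"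
      proof
        assume conn: "Digraph_Component.connected K"
        (* K itself may fail to be symmetric, so maximality of H is played against the induced graph. *)
        let ?I = "G \<restriction> verts K"
        have KV: "verts K \<subseteq> verts G" using K(3) by auto
        have KI: "subgraph K ?I" using K(3) by (rule subgraph_induce_subgraphI2)
        have "Digraph_Component.connected ?I"
          using mono conn KI unfolding arc_mono_def by (metis induce_subgraph_verts)
        then have "strongly_connected ?I"
          using strong KV by auto
        moreover have "subgraph ?I G" using KV by (rule subgraph_induce_subgraphI)
        moreover have HI: "subgraph H ?I" using K(2) KI by (rule subgraph_trans)
        ultimately have "?I = H"
          using S unfolding max_subgraph_def by blast
        then have "subgraph K H" using KI by simp
        then have "K = H"
          using K(2) unfolding subgraph_def compatible_def
          by (intro pre_digraph.equality) auto
        with K(1) show False by simp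
      qed
    qed
  qed
  then show ?thesis
    unfolding connected_components_def sccs_altdef2 by blast
qed

lemma (in sym_digraph) card_connected_components:
  "card (connected_components G) = card (scc_of ` verts G)"
  by (simp add: connected_components_eq_sccs flip: card_sccs_verts sccs_verts_conv_scc_of)

section \<open>Residue classes in a graph on an interval\<close>

text \<open>
  The arcs of the contraction, with a vertex \<open>[i]\<^sub>d\<close> replaced by the number \<open>i mod d\<close>. Unlike the
  classes, these numbers do not depend on the vertex set, so that two graphs of different orders can
  be compared by an equation.
\<close>
definition residue_arcs :: "nat pair_pre_digraph \<Rightarrow> nat \<Rightarrow> (nat \<times> nat) set" where
  "residue_arcs G d = {(x mod d, y mod d) | x y. (x, y) \<in> parcs G \<and> x mod d \<noteq> y mod d}"

lemma residue_arcsI: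
  "\<lbrakk>(x, y) \<in> parcs G; x mod d = i; y mod d = j; i \<noteq> j\<rbrakk> \<Longrightarrow> (i, j) \<in> residue_arcs G d"
  unfolding residue_arcs_def by blast

definition residue_connected :: "nat pair_pre_digraph \<Rightarrow> nat \<Rightarrow> bool" where
  "residue_connected G d \<longleftrightarrow>
     (\<forall>x\<in>pverts G. \<forall>y\<in>pverts G. [x = y] (mod d) \<longrightarrow> x \<rightarrow>\<^sup>*\<^bsub>with_proj G\<^esub> y)"

lemma residue_connectedD:
  "\<lbrakk>residue_connected G d; x \<in> pverts G; y \<in> pverts G; [x = y] (mod d)\<rbrakk>
    \<Longrightarrow> x \<rightarrow>\<^sup>*\<^bsub>with_proj G\<^esub> y"
  unfolding residue_connected_def by blast

lemma residue_representative:
  assumes "0 < (d :: nat)" obtains z where "z \<in> {1..d}" "[x = z] (mod d)"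
proof
  let ?z = "if x mod d = 0 then d else x mod d"
  show "?z \<in> {1..d}" using assms by (auto simp: less_imp_le Suc_le_eq)
  show "[x = ?z] (mod d)" by (auto simp: cong_def)
qed

locale interval_graph = pair_sym_digraph G for G :: "nat pair_pre_digraph" +
  fixes n :: nat
  assumes pverts_eq: "pverts G = {1..n}"
begin

definition has_step :: "nat \<Rightarrow> bool" where
  "has_step s \<longleftrightarrow> (\<forall>x. 1 \<le> x \<and> x + s \<le> n \<longrightarrow> (x, x + s) \<in> parcs G)"

lemma has_step_reachable:
  assumes "has_step s" "1 \<le> x" "x + s \<le> n" shows "x \<rightarrow>\<^sup>*\<^bsub>with_proj G\<^esub> (x + s)"
  using assms unfolding has_step_def by (auto intro: reachable_adjI)

lemma has_step_imp_residue_connected: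
  assumes "has_step d" shows "residue_connected G d"
proof -
  have up: "x \<rightarrow>\<^sup>*\<^bsub>with_proj G\<^esub> (x + k * d)" if "1 \<le> x" "x + k * d \<le> n" for x k
    using that
  proof (induction k)
    case 0
    then show ?case by (auto simp: pverts_eq)
  next
    case (Suc k)
    then have "x \<rightarrow>\<^sup>*\<^bsub>with_proj G\<^esub> (x + k * d)" by simp
    also have "(x + k * d) \<rightarrow>\<^sup>*\<^bsub>with_proj G\<^esub> (x + k * d + d)"
      using Suc.prems by (intro has_step_reachable assms) auto
    finally show ?case by (simp add: algebra_simps)
  qed
  have le: "x \<rightarrow>\<^sup>*\<^bsub>with_proj G\<^esub> y" if xy: "1 \<le> x" "y \<le> n" "x \<le> y" "[x = y] (mod d)" for x y
  proof -
    obtain k where "y = k * d + x"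
      using cong_le_nat[OF xy(3), of d] cong_sym[OF xy(4)] by blast
    then show ?thesis using up[of x k] xy by (simp add: add.commute)
  qed
  show ?thesis
    unfolding residue_connected_def pverts_eq
    by (metis atLeastAtMost_iff cong_sym le nle_le symmetric_reachable')
qed

text \<open>
  The inductive step of the algorithm. Moving by \<open>s\<close> is possible from every vertex up to congruence
  modulo \<open>d\<close>, because the vertex may first be exchanged for its representative in \<open>{1..d}\<close>. By
  Bezout, vertices congruent modulo \<open>gcd d s\<close> differ by some number of such moves.
\<close>
lemma residue_connected_gcd:
  assumes conn: "residue_connected G d" and step: "has_step s"
    and d: "0 < d" "d \<le> n" and s: "s \<le> n - d"
  shows "residue_connected G (gcd d s)"
proof -
  have walk: "x \<rightarrow>\<^sup>*\<^bsub>with_proj G\<^esub> y" if "x \<in> {1..n}" "y \<in> {1..n}" "[x + k * s = y] (mod d)" for x y k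
    using that
  proof (induction k arbitrary: x)
    case 0
    then show ?case using conn by (auto simp: pverts_eq intro: residue_connectedD)
  next
    case (Suc k)
    obtain z where z: "z \<in> {1..d}" "[x = z] (mod d)"
      using d(1) by (rule residue_representative)
    have "x \<rightarrow>\<^sup>*\<^bsub>with_proj G\<^esub> z"
      using Suc.prems z d by (intro residue_connectedD[OF conn]) (auto simp: pverts_eq)
    also have "z \<rightarrow>\<^sup>*\<^bsub>with_proj G\<^esub> (z + s)"
      using z s d by (intro has_step_reachable step) auto
    also have "(z + s) \<rightarrow>\<^sup>*\<^bsub>with_proj G\<^esub> y"
    proof (rule Suc.IH)
      show "z + s \<in> {1..n}" using z s d by auto
      have "[z + (s + k * s) = x + (s + k * s)] (mod d)"
        using z(2) by (intro cong_add cong_refl) (rule cong_sym)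
      then show "[z + s + k * s = y] (mod d)"
        using Suc.prems(3) by (auto simp: algebra_simps intro: cong_trans)
    qed (use Suc.prems in auto)
    finally show ?case .
  qed
  have "x \<rightarrow>\<^sup>*\<^bsub>with_proj G\<^esub> y" if xy: "x \<in> {1..n}" "y \<in> {1..n}" "[x = y] (mod gcd d s)" for x y
  proof -
    obtain u v where uv: "u * int d + v * int s = int (gcd d s)"
      using bezout_int[of "int d" "int s"] by auto
    have "int (gcd d s) dvd int y - int x"
      using xy(3) by (metis cong_int_iff cong_iff_dvd_diff cong_sym)
    then obtain t where t: "int y - int x = int (gcd d s) * t" by (elim dvdE)
    (* The Bezout coefficient t * v may be negative; modulo d it is a number of moves. *)
    define k where "k = nat ((t * v) mod int d)"
    have k: "int k = (t * v) mod int d"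
      unfolding k_def using d by simp
    have "[int x + int k * int s = int x + t * v * int s] (mod int d)"
      unfolding k by (intro cong_add cong_mult cong_refl) (simp add: cong_def)
    also have "int x + t * v * int s = int y + int d * (- (t * u))"
      using t unfolding uv[symmetric] by (simp add: algebra_simps)
    also have "[int y + int d * (- (t * u)) = int y] (mod int d)"
      by (simp add: cong_def del: mult_minus_right)
    finally have "[x + k * s = y] (mod d)"
      by (simp flip: cong_int_iff)
    with xy(1,2) show ?thesis by (rule walk)
  qed
  then show ?thesis
    unfolding residue_connected_def pverts_eq by blast
qed

text \<open>The loop condition \<open>Min S \<le> n - d\<close> is exactly the room that a move by \<open>Min S\<close> needs.\<close>
lemma residue_connected_DA_loop:
  assumes "finite S" "\<forall>s\<in>S. has_step s" "residue_connected G d" "0 < d" "d \<le> n"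
  shows "residue_connected G (DA_loop n d S)"
  using assms
proof (induction S arbitrary: d rule: finite_psubset_induct)
  case (psubset S)
  show ?case
  proof (cases "S \<noteq> {} \<and> Min S \<le> n - d")
    case True
    then have m: "Min S \<in> S" using psubset.hyps by simp
    have "gcd d (Min S) \<le> d" using \<open>0 < d\<close> by (simp add: gcd_le1_nat)
    then have "gcd d (Min S) \<le> n" using \<open>d \<le> n\<close> by simp
    then have "residue_connected G (DA_loop n (gcd d (Min S)) (S - {Min S}))"
      using m True psubset.prems by (intro psubset.IH residue_connected_gcd) auto
    then show ?thesis
      using True psubset.hyps by (subst DA_loop.simps) simp
  next
    case False
    then show ?thesis
      using psubset.prems by (subst DA_loop.simps) auto
  qed
qed

end

text \<open>
  An element of \<open>S\<close> that the loop has processed is a multiple of the output; when the loop stops,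
  the least remaining element is too large, and so are all the others.
\<close>
lemma DA_loop_dvd_or_large:
  assumes "finite S" "0 < d"
  shows "0 < DA_loop n d S \<and> DA_loop n d S dvd d \<and>
    (\<forall>s\<in>S. DA_loop n d S dvd s \<or> n - DA_loop n d S < s)"
  using assms
proof (induction S arbitrary: d rule: finite_psubset_induct)
  case (psubset S)
  show ?case
  proof (cases "S \<noteq> {} \<and> Min S \<le> n - d")
    case True
    let ?e = "DA_loop n (gcd d (Min S)) (S - {Min S})"
    have m: "Min S \<in> S" using True psubset.hyps by simp
    have e: "DA_loop n d S = ?e"
      using True psubset.hyps by (subst DA_loop.simps) simp
    have IH: "0 < ?e" "?e dvd gcd d (Min S)" "\<forall>s\<in>S - {Min S}. ?e dvd s \<or> n - ?e < s"
      using psubset.IH[of "S - {Min S}" "gcd d (Min S)"] m psubset.prems by auto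
    then show ?thesis unfolding e by auto
  next
    case False
    then have "DA_loop n d S = d"
      by (subst DA_loop.simps) auto
    moreover have "\<forall>s\<in>S. n - d < s"
    proof
      fix s assume "s \<in> S"
      then have "Min S \<le> s" using psubset.hyps by simp
      with False \<open>s \<in> S\<close> show "n - d < s" by auto
    qed
    ultimately show ?thesis using psubset.prems by auto
  qed
qed

section \<open>Graphs with the same adjacent residues\<close>

lemma residue_class_eq_iff:
  assumes "pverts G = {1..n}" "d \<le> n" "i \<in> {1..d}" "j \<in> {1..d}"
  shows "residue_class G d i = residue_class G d j \<longleftrightarrow> i mod d = j mod d"
proof -
  have "i \<in> residue_class G d i"
    using assms by (auto simp: residue_class_def)
  then show ?thesis
    by (auto simp: residue_class_def cong_def)
qed

lemma contraction_arc_iff: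
  assumes "interval_graph G n" "d \<le> n" "i \<in> {1..d}" "j \<in> {1..d}"
  shows "(residue_class G d i, residue_class G d j) \<in> parcs (contraction G d) \<longleftrightarrow>
    (i mod d, j mod d) \<in> residue_arcs G d"
proof -
  interpret interval_graph G n by fact
  have "(\<exists>x\<in>residue_class G d i. \<exists>y\<in>residue_class G d j. (x, y) \<in> parcs G) \<longleftrightarrow>
    (\<exists>x y. x mod d = i mod d \<and> y mod d = j mod d \<and> (x, y) \<in> parcs G)"
    unfolding residue_class_def cong_def by (blast dest: in_arcsD1 in_arcsD2)
  moreover have "(i mod d, j mod d) \<in> residue_arcs G d \<longleftrightarrow> i mod d \<noteq> j mod d \<and>
    (\<exists>x y. x mod d = i mod d \<and> y mod d = j mod d \<and> (x, y) \<in> parcs G)"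
    unfolding residue_arcs_def by (auto; metis)
  ultimately show ?thesis
    using assms(3,4) residue_class_eq_iff[OF pverts_eq assms(2-4)]
    unfolding contraction_def by simp
qed

lemma contraction_iso:
  assumes G: "interval_graph G n" "d \<le> n" and H: "interval_graph H m" "d \<le> m"
    and eq: "residue_arcs G d = residue_arcs H d"
  shows "digraph_iso (with_proj (contraction G d)) (with_proj (contraction H d))"
proof -
  interpret G: interval_graph G n by fact
  interpret H: interval_graph H m by fact
  let ?C = "with_proj (contraction G d)" and ?D = "with_proj (contraction H d)"
  (* As d \<le> n, no class of G is empty, so f sends each class to the class of H with that residue. *)
  define f where "f X = {v \<in> pverts H. \<exists>x\<in>X. [v = x] (mod d)}" for X
  have f: "f (residue_class G d i) = residue_class H d i" if "i \<in> {1..d}" for i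
  proof -
    have "i \<in> residue_class G d i"
      using that G(2) by (auto simp: residue_class_def G.pverts_eq)
    then show ?thesis
      unfolding f_def residue_class_def by (auto intro: cong_trans)
  qed
  have verts: "verts ?C = residue_class G d ` {1..d}" "verts ?D = residue_class H d ` {1..d}"
    by (simp_all add: contraction_def)
  have inj: "inj_on f (verts ?C)"
    unfolding verts
    using residue_class_eq_iff[OF G.pverts_eq G(2)] residue_class_eq_iff[OF H.pverts_eq H(2)]
    by (auto simp: inj_on_def f)
  have arc: "(residue_class G d i, residue_class G d j) \<in> arcs ?C \<longleftrightarrow>
      (residue_class H d i, residue_class H d j) \<in> arcs ?D" if "i \<in> {1..d}" "j \<in> {1..d}" for i j
    using contraction_arc_iff[OF G that] contraction_arc_iff[OF H that] eq by simp
  have arcsC: "arcs ?C \<subseteq> verts ?C \<times> verts ?C" and arcsD: "arcs ?D \<subseteq> verts ?D \<times> verts ?D"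
    by (auto simp: contraction_def)
  have image: "arcs ?D = map_prod f f ` arcs ?C"
  proof (intro equalityI subsetI)
    fix e assume e: "e \<in> arcs ?D"
    then obtain i j where ij: "i \<in> {1..d}" "j \<in> {1..d}"
      "e = (residue_class H d i, residue_class H d j)"
      using subsetD[OF arcsD e] unfolding verts by auto
    then have "(residue_class G d i, residue_class G d j) \<in> arcs ?C"
      using e arc[OF ij(1,2)] by simp
    then have "map_prod f f (residue_class G d i, residue_class G d j) \<in> map_prod f f ` arcs ?C"
      by (rule imageI)
    then show "e \<in> map_prod f f ` arcs ?C"
      by (simp only: ij(3) map_prod_simp f[OF ij(1)] f[OF ij(2)])
  next
    fix e assume "e \<in> map_prod f f ` arcs ?C"
    then obtain c where c: "c \<in> arcs ?C" "e = map_prod f f c" by (elim imageE) simp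
    then obtain i j where ij: "i \<in> {1..d}" "j \<in> {1..d}"
      "c = (residue_class G d i, residue_class G d j)"
      using subsetD[OF arcsC c(1)] unfolding verts by auto
    show "e \<in> arcs ?D"
      using c(1) unfolding c(2) ij(3) map_prod_simp f[OF ij(1)] f[OF ij(2)] arc[OF ij(1,2)] .
  qed
  let ?h = "\<lparr>iso_verts = f, iso_arcs = map_prod f f, iso_head = snd, iso_tail = fst\<rparr>"
  have "wf_digraph ?C"
    by unfold_locales (auto simp: contraction_def)
  moreover have "inj_on (map_prod f f) (arcs ?C)"
    using map_prod_inj_on[OF inj inj] arcsC by (rule inj_on_subset)
  ultimately have "pre_digraph.digraph_isomorphism ?C ?h"
    using inj unfolding pre_digraph.digraph_isomorphism_def by auto
  moreover have "?D = app_iso ?h ?C"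
  proof (rule pre_digraph.equality)
    show "verts ?D = verts (app_iso ?h ?C)"
      unfolding verts verts_app_iso using f by (auto simp: image_image)
    show "arcs ?D = arcs (app_iso ?h ?C)"
      unfolding arcs_app_iso using image by simp
  qed auto
  ultimately show ?thesis unfolding digraph_iso_def by blast
qed

text \<open>
  A walk in \<open>G\<close> is simulated in \<open>H\<close> residue by residue: an arc within a residue class needs no move,
  and an arc between two classes is matched by an arc of \<open>H\<close> between the same classes, whose ends
  can be reached inside the connected classes of \<open>H\<close>.
\<close>
lemma reachable_transfer_residues:
  assumes "interval_graph G n" and H: "interval_graph H m" "residue_connected H d" "d \<le> m" "0 < d"
    and sub: "residue_arcs G d \<subseteq> residue_arcs H d"
    and reach: "x \<rightarrow>\<^sup>*\<^bsub>with_proj G\<^esub> y"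
    and x: "x' \<in> pverts H" "[x = x'] (mod d)" and y: "y' \<in> pverts H" "[y = y'] (mod d)"
  shows "x' \<rightarrow>\<^sup>*\<^bsub>with_proj H\<^esub> y'"
proof -
  interpret G: interval_graph G n by fact
  interpret H: interval_graph H m by fact
  show ?thesis
    using reach x
  proof (induction arbitrary: x' rule: G.converse_reachable_induct)
    case base
    then have "[x' = y'] (mod d)" using y by (meson cong_sym cong_trans)
    with base y H(2) show ?case by (auto intro: residue_connectedD)
  next
    case (step x z)
    show ?case
    proof (cases "x mod d = z mod d")
      case True
      then show ?thesis
        using step.prems by (intro step.IH) (auto simp: cong_def)
    next
      case False
      then have "(x mod d, z mod d) \<in> residue_arcs G d"
        using step.hyps(1) by (auto intro: residue_arcsI)
      then have "(x mod d, z mod d) \<in> residue_arcs H d"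
        using sub by blast
      then obtain u v where uv: "(u, v) \<in> parcs H" "x mod d = u mod d" "z mod d = v mod d"
        by (auto simp: residue_arcs_def)
      have "x' \<rightarrow>\<^sup>*\<^bsub>with_proj H\<^esub> u"
        using step.prems uv H.in_arcsD1 by (intro residue_connectedD[OF H(2)]) (auto simp: cong_def)
      also have "u \<rightarrow>\<^sup>*\<^bsub>with_proj H\<^esub> v" using uv by auto
      also have "v \<rightarrow>\<^sup>*\<^bsub>with_proj H\<^esub> y'"
        using uv H.in_arcsD2 by (intro step.IH) (auto simp: cong_def)
      finally show ?thesis .
    qed
  qed
qed

text \<open>
  Every component of either graph meets \<open>{1..d}\<close>, a set of vertices of both graphs, and on this set
  the two reachability relations coincide.
\<close>
lemma card_connected_components_eq:
  assumes G: "interval_graph G n" "residue_connected G d" "d \<le> n"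
    and H: "interval_graph H m" "residue_connected H d" "d \<le> m"
    and d: "0 < d" and eq: "residue_arcs G d = residue_arcs H d"
  shows "card (connected_components (with_proj G)) = card (connected_components (with_proj H))"
proof -
  have scc_eq: "pre_digraph.scc_of (with_proj K) x = pre_digraph.scc_of (with_proj K) y \<longleftrightarrow>
      x \<rightarrow>\<^sup>*\<^bsub>with_proj K\<^esub> y"
    if "interval_graph K k" "x \<in> {1..k}" "y \<in> {1..k}" for K k x y
  proof -
    interpret interval_graph K k by fact
    have "y \<in> scc_of y"
      using that(3) by (intro in_scc_of_self) (simp add: pverts_eq)
    then show ?thesis
      using scc_of_eq[of x y] scc_ofI_reachable[of x y] unfolding scc_of_def by blast
  qed
  have reps: "card (connected_components (with_proj K)) =
      card (pre_digraph.scc_of (with_proj K) ` {1..d})"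
    if K: "interval_graph K k" "residue_connected K d" "d \<le> k" for K k
  proof -
    interpret interval_graph K k by fact
    have "scc_of x \<in> scc_of ` {1..d}" if "x \<in> {1..k}" for x
    proof -
      obtain z where z: "z \<in> {1..d}" "[x = z] (mod d)"
        using d by (rule residue_representative)
      then have "x \<rightarrow>\<^sup>*\<^bsub>with_proj K\<^esub> z"
        using that K by (intro residue_connectedD[OF K(2)]) (auto simp: pverts_eq)
      then have "scc_of x = scc_of z"
        using scc_eq[OF K(1), of x z] that z K(3) by auto
      then show ?thesis using z(1) by blast
    qed
    then have "scc_of ` pverts K = scc_of ` {1..d}"
      using K(3) by (auto simp: pverts_eq)
    then show ?thesis by (simp add: card_connected_components)
  qed
  let ?g = "pre_digraph.scc_of (with_proj G)" and ?h = "pre_digraph.scc_of (with_proj H)"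
  have same: "?g x = ?g y \<longleftrightarrow> ?h x = ?h y" if "x \<in> {1..d}" "y \<in> {1..d}" for x y
  proof -
    interpret G: interval_graph G n by fact
    interpret H: interval_graph H m by fact
    have "x \<rightarrow>\<^sup>*\<^bsub>with_proj G\<^esub> y \<longleftrightarrow> x \<rightarrow>\<^sup>*\<^bsub>with_proj H\<^esub> y"
      using that reachable_transfer_residues[OF G(1) H d, of x y x y]
        reachable_transfer_residues[OF H(1) G d, of x y x y] eq G(3) H(3)
      by (auto simp: G.pverts_eq H.pverts_eq)
    then show ?thesis
      using scc_eq[OF G(1), of x y] scc_eq[OF H(1), of x y] that G(3) H(3) by auto
  qed
  have "bij_betw (\<lambda>S. ?h (inv_into {1..d} ?g S)) (?g ` {1..d}) (?h ` {1..d})"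
  proof -
    have "?h (inv_into {1..d} ?g (?g x)) = ?h x" if "x \<in> {1..d}" for x
      using same that f_inv_into_f[of "?g x" ?g "{1..d}"] inv_into_into[of "?g x" ?g "{1..d}"] by blast
    then show ?thesis
      using same by (intro bij_betw_imageI) (auto simp: inj_on_def image_image)
  qed
  then have "card (?g ` {1..d}) = card (?h ` {1..d})" by (rule bij_betw_same_card)
  then show ?thesis using reps G H by simp
qed

section \<open>Toeplitz graphs\<close>

lemma toeplitz_support_toeplitz:
  "0 < n \<Longrightarrow> toeplitz_support (toeplitz n a) = {i. i < n \<and> a i \<noteq> 0}"
  by (auto simp: toeplitz_support_def toeplitz_def)

lemma toeplitz_graph_arc_iff:
  "(x, y) \<in> parcs (toeplitz_graph (toeplitz n a)) \<longleftrightarrow>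
    x \<in> {1..n} \<and> y \<in> {1..n} \<and> a (nat \<bar>int x - int y\<bar>) \<noteq> 0"
proof (cases "0 < n")
  case True
  then show ?thesis
    by (auto simp: toeplitz_graph_def toeplitz_support_toeplitz) (auto simp: toeplitz_def)
qed (auto simp: toeplitz_graph_def toeplitz_def)

lemma interval_graph_toeplitz: "interval_graph (toeplitz_graph (toeplitz n a)) n"
proof
  show "symmetric (with_proj (toeplitz_graph (toeplitz n a)))"
    by (auto simp: symmetric_def sym_def toeplitz_graph_arc_iff abs_minus_commute)
qed (auto simp: toeplitz_graph_def toeplitz_def)

lemma has_step_toeplitz:
  "a s \<noteq> 0 \<Longrightarrow> interval_graph.has_step (toeplitz_graph (toeplitz n a)) n s"
  by (auto simp: interval_graph.has_step_def[OF interval_graph_toeplitz] toeplitz_graph_arc_iff)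

text \<open>
  It is enough to shorten or lengthen each edge at its upper end \<open>x + s\<close>, keeping the lower end \<open>x\<close>.
\<close>
lemma residue_arcs_toeplitz_subset:
  assumes "\<And>x s. \<lbrakk>1 \<le> x; x + s \<le> n; a s \<noteq> 0; \<not> d dvd s\<rbrakk>
    \<Longrightarrow> \<exists>t. x + t \<le> m \<and> b t \<noteq> 0 \<and> [s = t] (mod d)"
  shows "residue_arcs (toeplitz_graph (toeplitz n a)) d \<subseteq>
    residue_arcs (toeplitz_graph (toeplitz m b)) d"
proof -
  let ?G = "toeplitz_graph (toeplitz n a)" and ?H = "toeplitz_graph (toeplitz m b)"
  have up: "\<exists>t. (x, x + t) \<in> parcs ?H \<and> (x + t, x) \<in> parcs ?H \<and> (x + t) mod d = y mod d"
    if xy: "x \<le> y" "(x, y) \<in> parcs ?G \<or> (y, x) \<in> parcs ?G" "x mod d \<noteq> y mod d" for x y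
  proof -
    define s where "s = y - x"
    have y: "y = x + s" using xy(1) by (simp add: s_def)
    have s: "1 \<le> x" "x + s \<le> n" "a s \<noteq> 0"
      using xy(2) by (auto simp: toeplitz_graph_arc_iff y)
    moreover have "\<not> d dvd s"
      using xy(3) by (auto simp: y elim!: dvdE)
    ultimately obtain t where t: "x + t \<le> m" "b t \<noteq> 0" "[s = t] (mod d)"
      using assms by blast
    moreover have "[x + t = y] (mod d)"
      unfolding y using t(3) by (intro cong_add cong_refl) (rule cong_sym)
    ultimately show ?thesis
      using s by (intro exI[of _ t]) (auto simp: toeplitz_graph_arc_iff cong_def)
  qed
  show ?thesis
  proof
    fix e assume "e \<in> residue_arcs ?G d"
    then obtain x y where xy: "e = (x mod d, y mod d)" "(x, y) \<in> parcs ?G" "x mod d \<noteq> y mod d"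
      by (auto simp: residue_arcs_def)
    show "e \<in> residue_arcs ?H d"
    proof (cases "x \<le> y")
      case True
      then obtain t where "(x, x + t) \<in> parcs ?H" "(x + t) mod d = y mod d"
        using up xy by blast
      then show ?thesis using xy by (auto intro: residue_arcsI)
    next
      case False
      then obtain t where "(y + t, y) \<in> parcs ?H" "(y + t) mod d = x mod d"
        using up[of y x] xy by auto
      then show ?thesis using xy by (auto intro: residue_arcsI)
    qed
  qed
qed

theorem theorem3p8:
  fixes n d q r :: nat
    and a :: "nat \<Rightarrow> 'a::zero_neq_one"
    and A B :: "'a mat"
  assumes "A = toeplitz n a" and "a 0 = 0" and "boolean_mat A"
    and "toeplitz_support A \<noteq> {}" and "2 * Min (toeplitz_support A) \<le> n"
    and "d = DA n (toeplitz_support A)"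
    and "n = q * d + r" and "r < d"
    and "B = toeplitz (d + r)
               (\<lambda>i. if i \<le> r then 0 else if i = d then 1 else a ((q - 1) * d + i))"
  shows "digraph_iso (with_proj (contraction (toeplitz_graph A) d))
                     (with_proj (contraction (toeplitz_graph B) d)) \<and>
         card (connected_components (with_proj (toeplitz_graph A))) =
         card (connected_components (with_proj (toeplitz_graph B)))"
proof -
  let ?S = "toeplitz_support A"
  define b where "b i = (if i \<le> r then 0 else if i = d then 1 else a ((q - 1) * d + i))" for i
  have B: "B = toeplitz (d + r) b"
    unfolding assms(9) b_def ..
  have "0 < n" using assms(1,4) by (cases n) (auto simp: toeplitz_support_def toeplitz_def)
  then have S: "?S = {i. i < n \<and> a i \<noteq> 0}"
    using assms(1) by (simp add: toeplitz_support_toeplitz)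
  then have fin: "finite ?S" by simp
  then have m: "Min ?S \<in> ?S" using assms(4) by (rule Min_in)
  then have m0: "0 < Min ?S" using S assms(2) by (metis (mono_tags, lifting) gr0I mem_Collect_eq)
  have m_le: "Min ?S \<le> n" using assms(5) by simp
  have d: "d = DA_loop n (Min ?S) (?S - {Min ?S})"
    using assms(6) by (simp add: DA_def)
  have props: "0 < d \<and> d dvd Min ?S \<and> (\<forall>s\<in>?S - {Min ?S}. d dvd s \<or> n - d < s)"
    unfolding d using fin m0 by (intro DA_loop_dvd_or_large) auto
  then have "0 < d" and large: "\<And>s. s \<in> ?S \<Longrightarrow> \<not> d dvd s \<Longrightarrow> n - d < s"
    by blast+
  have "d \<le> n" using props m0 m_le by (meson dvd_imp_le le_trans)
  then have "q \<noteq> 0" using assms(7,8) by (cases q) auto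
  then have n: "n = (q - 1) * d + d + r" 
    using assms(7) by (cases q) auto
  interpret A: interval_graph "toeplitz_graph A" n
    unfolding assms(1) by (rule interval_graph_toeplitz)
  interpret B: interval_graph "toeplitz_graph B" "d + r"
    unfolding B by (rule interval_graph_toeplitz)
  have step: "\<forall>s\<in>?S. A.has_step s"
    using S has_step_toeplitz assms(1) by auto
  have A_conn: "residue_connected (toeplitz_graph A) d"
    unfolding d
    using fin step m m0 m_le
    by (intro A.residue_connected_DA_loop A.has_step_imp_residue_connected) auto
  have "b d \<noteq> 0" using \<open>r < d\<close> by (simp add: b_def)
  then have "B.has_step d" unfolding B by (rule has_step_toeplitz)
  then have B_conn: "residue_connected (toeplitz_graph B) d"
    by (rule B.has_step_imp_residue_connected)
  (* A length s in A corresponds to the length t in B with s = (q - 1) * d + t. *)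
  have eq: "residue_arcs (toeplitz_graph A) d = residue_arcs (toeplitz_graph B) d"
    unfolding assms(1) B
  proof (intro equalityI residue_arcs_toeplitz_subset)
    fix x s assume x: "1 \<le> x" "x + s \<le> n" "a s \<noteq> 0" "\<not> d dvd s"
    then have "n - d < s" using large S by auto
    then have *: "(q - 1) * d + r < s" using n by simp
    define t where "t = s - (q - 1) * d"
    have t: "s = (q - 1) * d + t" using * by (simp add: t_def)
    have "r < t" "t \<noteq> d" using * x(4) by (auto simp: t)
    then have "b t \<noteq> 0" using x(3) by (simp add: b_def t)
    moreover have "x + t \<le> d + r" using x(2) n t by simp
    moreover have "[s = t] (mod d)" by (simp add: t cong_def)
    ultimately show "\<exists>t. x + t \<le> d + r \<and> b t \<noteq> 0 \<and> [s = t] (mod d)" by blast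
  next
    fix x s assume x: "1 \<le> x" "x + s \<le> d + r" "b s \<noteq> 0" "\<not> d dvd s"
    let ?t = "(q - 1) * d + s"
    have "a ?t \<noteq> 0" using x(3,4) by (auto simp: b_def split: if_splits)
    moreover have "x + ?t \<le> n" using x(2) n by simp
    moreover have "[s = ?t] (mod d)" by (simp add: cong_def)
    ultimately show "\<exists>t. x + t \<le> n \<and> a t \<noteq> 0 \<and> [s = t] (mod d)" by blast
  qed
  show ?thesis
    using contraction_iso[OF A.interval_graph_axioms \<open>d \<le> n\<close> B.interval_graph_axioms _ eq]
      card_connected_components_eq[OF A.interval_graph_axioms A_conn \<open>d \<le> n\<close>
        B.interval_graph_axioms B_conn _ \<open>0 < d\<close> eq]
    by simp
qed

end
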